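(* Let $(X,d)$ be a compact metric space and let $f:X\to X$ be a positively expansive continuous map with the specification property. Then $$h_{top}(f)=\mathcal{E}(f_{\mathcal{K}},\mathcal{K}_f(X)).$$
   Context: $h_{top}(f)$ is topological entropy; $d_n(x,y)=\max_{0\le i\le n-1} d(f^ix,f^iy)$. $\mathcal K(X)$ is the space of nonempty closed subsets of $X$, $f_{\mathcal K}(B)=f(B)$, and $\mathcal K_f(X)=\{B\in\mathcal K(X): f(B)=B\}$. For $A\subset X$, $A^\varepsilon_n=\{x: d_n(x,A)<\varepsilon\}$; $H^n(B,C)=\inf\{\varepsilon>0: B\subset C^\varepsilon_n,\ C\subset B^\varepsilon_n\}$. For nonempty $\mathcal Z\subset\mathcal K(X)$, $N_{\mathcal K}(\mathcal Z,n,\varepsilon)$ is the smallest cardinality of $\mathcal G\subset\mathcal K(X)$ with every $B\in\mathcal Z$ within $H^n$-distance $\le\varepsilon$ of some element of $\mathcal G$, and $\mathcal E(f_{\mathcal K},\mathcal Z)=\lim_{\varepsilon\to0}\limsup_{n\to\infty}\frac{\log\log N_{\mathcal K}(\mathcal Z,n,\varepsilon)}{n}$ (convention $\log0=0$). $f$ is positively expansive if there is $\rho>0$ such that for distinct $x,y$ there is $n\ge0$ with $d(f^nx,f^ny)>\rho$. $f$ has the specification property if for every $\varepsilon>0$ there is $n_0$ such that for any $x_1,\dots,x_k\in X$ and nonnegative integers $n_1,\dots,n_k$, $s_1,\dots,s_k$ with $s_i\ge n_0$, writing $m_j=\sum_{i=1}^j(n_i+s_i)$, $m_0=0$, there is $p\in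 X$ with $d(f^{m_{j-1}+i}p,f^ix_j)<\varepsilon$ for $0\le i<n_j$, $1\le j\le k$. *)

theory Defs
  imports "HOL-Analysis.Analysis"
begin

definition dn :: "('a::metric_space \<Rightarrow> 'a) \<Rightarrow> nat \<Rightarrow> 'a \<Rightarrow> 'a \<Rightarrow> real" where
  "dn f n x y = Max (insert 0 ((\<lambda>i. dist ((f^^i) x) ((f^^i) y)) ` {..<n}))"

definition span_num :: "('a::metric_space \<Rightarrow> 'a) \<Rightarrow> nat \<Rightarrow> real \<Rightarrow> nat" where
  "span_num f n e = Inf {card S | S. finite S \<and> (\<forall>x. \<exists>y\<in>S. dn f n x y < e)}"

definition htop :: "('a::metric_space \<Rightarrow> 'a) \<Rightarrow> ereal" where
  "htop f = Lim (at_right 0)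
     (\<lambda>e. limsup (\<lambda>n. ereal (ln (real (span_num f n e)) / real n)))"

definition hyperspace :: "'a::metric_space set set" where
  "hyperspace = {B. closed B \<and> B \<noteq> {}}"

definition inv_hyperspace :: "('a::metric_space \<Rightarrow> 'a) \<Rightarrow> 'a set set" where
  "inv_hyperspace f = {B \<in> hyperspace. f ` B = B}"

definition dn_set :: "('a::metric_space \<Rightarrow> 'a) \<Rightarrow> nat \<Rightarrow> 'a \<Rightarrow> 'a set \<Rightarrow> real" where
  "dn_set f n x A = (INF a\<in>A. dn f n x a)"

definition nbhd_n :: "('a::metric_space \<Rightarrow> 'a) \<Rightarrow> nat \<Rightarrow> real \<Rightarrow> 'a set \<Rightarrow> 'a set" where
  "nbhd_n f n e A = {x. dn_set f n x A < e}"

definition Hn :: "('a::metric_space \<Rightarrow> 'a) \<Rightarrow> nat \<Rightarrow> 'a set \<Rightarrow> 'a set \<Rightarrow> real" where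
  "Hn f n B C = Inf {e. e > 0 \<and> B \<subseteq> nbhd_n f n e C \<and> C \<subseteq> nbhd_n f n e B}"

definition NK :: "('a::metric_space \<Rightarrow> 'a) \<Rightarrow> 'a set set \<Rightarrow> nat \<Rightarrow> real \<Rightarrow> nat" where
  "NK f Z n e = Inf {card G | G. G \<subseteq> hyperspace \<and> finite G \<and>
                      (\<forall>B\<in>Z. \<exists>C\<in>G. Hn f n B C \<le> e)}"

text \<open>E(f_K, Z) = lim_{eps->0} limsup_n log log N_K(Z,n,eps) / n  (ln 0 = 0 in Isabelle).\<close>
definition EK :: "('a::metric_space \<Rightarrow> 'a) \<Rightarrow> 'a set set \<Rightarrow> ereal" where
  "EK f Z = Lim (at_right 0)
     (\<lambda>e. limsup (\<lambda>n. ereal (ln (ln (real (NK f Z n e))) / real n)))"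

definition pos_expansive :: "('a::metric_space \<Rightarrow> 'a) \<Rightarrow> bool" where
  "pos_expansive f \<longleftrightarrow> (\<exists>\<rho>>0. \<forall>x y. x \<noteq> y \<longrightarrow> (\<exists>n. dist ((f^^n) x) ((f^^n) y) > \<rho>))"

definition has_specification :: "('a::metric_space \<Rightarrow> 'a) \<Rightarrow> bool" where
  "has_specification f \<longleftrightarrow> (\<forall>e>0. \<exists>n0. \<forall>(k::nat) (x::nat \<Rightarrow> 'a) (n::nat \<Rightarrow> nat) (s::nat \<Rightarrow> nat).
      (\<forall>i\<in>{1..k}. s i \<ge> n0) \<longrightarrow>
      (\<exists>p. \<forall>j\<in>{1..k}. \<forall>i<n j.
          dist ((f^^((\<Sum>l=1..j-1. n l + s l) + i)) p) ((f^^i) (x j)) < e))"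

end

theory Submission
  imports Defs "HOL-Real_Asymp.Real_Asymp"
begin

text \<open>
  Subsets of an \<open>(n, \<epsilon>)\<close>-spanning set form an \<open>H\<^sup>n\<close>-net of the hyperspace, which bounds
  its exponent by the entropy.

  Conversely, let \<open>S\<close> be a maximal \<open>(n, r)\<close>-separated set and let \<open>s\<close> be the gap length given by
  specification at a scale \<open>\<epsilon>\<close> small compared with \<open>r\<close>. For \<open>x \<in> S\<close> the points that
  \<open>\<epsilon>\<close>-trace \<open>x, f x, \<dots>, f\<^bsup>n-1\<^esup> x\<close> over and over again, with period \<open>n + s\<close>, generate a closed
  invariant set \<open>B x\<close>. A window of length \<open>n\<close> of an orbit in \<open>B x\<close> is determined up to
  \<open>2\<epsilon>\<close> by its phase modulo \<open>n + s\<close> and by the behaviour during one gap, so \<open>B x\<close> comes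
  close to at most \<open>(n + s) K\<close> points of \<open>S\<close>, with \<open>K\<close> independent of \<open>n\<close>. A digraph of
  bounded in-degree has a large independent set, hence there is \<open>T \<subseteq> S\<close> with
  \<open>|T| \<ge> |S| / (2 (n + s) K + 1)\<close> such that no \<open>x \<in> T\<close> is close to \<open>B y\<close> for another \<open>y \<in> T\<close>.
  The unions of the \<open>B x\<close> over the \<open>2\<^bsup>|T|\<^esup> - 1\<close> nonempty subsets of \<open>T\<close> are then
  \<open>H\<^sup>n\<close>-separated closed invariant sets, and the linear factor disappears in the growth rate.
\<close>

subsection \<open>Bowen metrics, spanning and separated sets\<close>

lemma dn_less_iff: "dn f n x y < e \<longleftrightarrow> 0 < e \<and> (\<forall>i<n. dist ((f^^i) x) ((f^^i) y) < e)"
  by (auto simp: dn_def)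

lemma dn_le_iff: "dn f n x y \<le> e \<longleftrightarrow> 0 \<le> e \<and> (\<forall>i<n. dist ((f^^i) x) ((f^^i) y) \<le> e)"
  by (auto simp: dn_def)

lemma dn_nonneg: "0 \<le> dn f n x y"
  using dn_le_iff by blast

lemma dist_le_dn: "i < n \<Longrightarrow> dist ((f^^i) x) ((f^^i) y) \<le> dn f n x y"
  using dn_le_iff by blast

lemma dn_commute: "dn f n x y = dn f n y x"
  by (simp add: dn_def dist_commute)

lemma dn_triangle: "dn f n x z \<le> dn f n x y + dn f n y z"
proof -
  have "dist ((f^^i) x) ((f^^i) z) \<le> dn f n x y + dn f n y z" if "i < n" for i
    using dist_triangle[of "(f^^i) x" "(f^^i) z" "(f^^i) y"]
      dist_le_dn[OF that, of f x y] dist_le_dn[OF that, of f y z] by linarith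
  then show ?thesis
    using dn_nonneg[of f n x y] dn_nonneg[of f n y z] by (auto simp: dn_le_iff)
qed

lemma dn_refl: "dn f n x x = 0"
  using dn_nonneg[of f n x x] dn_le_iff[of f n x x 0] by auto

lemma dn_bounded:
  fixes f :: "'a::metric_space \<Rightarrow> 'a"
  assumes "compact (UNIV :: 'a set)"
  obtains D where "0 < D" "\<And>n x y. dn f n x y < D"
proof -
  obtain D0 where D0: "\<And>x y :: 'a. dist x y \<le> D0"
    using compact_imp_bounded[OF assms] unfolding bounded_two_points by auto
  have "0 \<le> D0" using D0[of undefined undefined] by simp
  then have "dn f n x y < D0 + 1" for n x y
    using le_less_trans[OF D0, of "D0 + 1"] by (auto simp: dn_less_iff)
  with \<open>0 \<le> D0\<close> show ?thesis by (intro that[of "D0 + 1"]) auto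
qed

lemma continuous_on_funpow:
  fixes f :: "'a::topological_space \<Rightarrow> 'a"
  assumes "continuous_on UNIV f"
  shows "continuous_on A (f ^^ i)"
proof (induction i)
  case (Suc i)
  show ?case
    using continuous_on_compose[OF Suc, of f] continuous_on_subset[OF assms] by simp
qed (simp add: id_def)

lemma finite_spanning_set:
  fixes f :: "'a::metric_space \<Rightarrow> 'a"
  assumes "compact (UNIV :: 'a set)" "continuous_on UNIV f" "0 < e"
  obtains S where "finite S" "\<And>x. \<exists>y\<in>S. dn f n x y < e"
proof -
  have op: "open {y. dn f n x y < e}" for x
  proof -
    have "{y. dn f n x y < e} = (\<Inter>i\<in>{..<n}. {y. dist ((f^^i) x) ((f^^i) y) < e})"
      using \<open>0 < e\<close> by (auto simp: dn_less_iff)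
    moreover have "open (\<Inter>i\<in>{..<n}. {y. dist ((f^^i) x) ((f^^i) y) < e})"
      by (intro open_INT open_Collect_less continuous_intros continuous_on_funpow assms ballI)
        simp_all
    ultimately show ?thesis by simp
  qed
  have cov: "UNIV \<subseteq> (\<Union>x\<in>UNIV. {y. dn f n x y < e})"
    using \<open>0 < e\<close> dn_refl[of f n] by auto
  obtain S where "S \<subseteq> UNIV" "finite S" and S: "UNIV \<subseteq> (\<Union>x\<in>S. {y. dn f n x y < e})"
    by (rule compactE_image[OF assms(1) op cov])
  show ?thesis
  proof (rule that)
    show "\<exists>y\<in>S. dn f n x y < e" for x
      using S by (auto simp: dn_commute[of f n x])
  qed fact
qed

text \<open>An infimum in \<open>nat\<close> is attained once the set is nonempty, and
  \<open>finite_spanning_set\<close> rules out the empty set, whose \<open>Inf\<close> would be a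
  meaningless default.\<close>

lemma span_num_attained:
  fixes f :: "'a::metric_space \<Rightarrow> 'a"
  assumes "compact (UNIV :: 'a set)" "continuous_on UNIV f" "0 < e"
  obtains S where "finite S" "\<And>x. \<exists>y\<in>S. dn f n x y < e" "card S = span_num f n e" "S \<noteq> {}"
proof -
  let ?A = "{card S | S. finite S \<and> (\<forall>x. \<exists>y\<in>S. dn f n x y < e)}"
  obtain S0 where "finite S0" "\<And>x. \<exists>y\<in>S0. dn f n x y < e"
    using finite_spanning_set[OF assms, of n] by blast
  then have "?A \<noteq> {}" by blast
  then have "span_num f n e \<in> ?A"
    unfolding span_num_def by (rule Inf_nat_def1)
  then obtain S where "finite S" "\<forall>x. \<exists>y\<in>S. dn f n x y < e" "span_num f n e = card S"
    by blast
  then show ?thesis by (intro that[of S]) auto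
qed

lemma span_num_le:
  assumes "finite S" "\<And>x. \<exists>y\<in>S. dn f n x y < e"
  shows "span_num f n e \<le> card S"
  unfolding span_num_def by (rule cInf_lower) (use assms in blast, rule bdd_below_bot)

lemma span_num_pos:
  fixes f :: "'a::metric_space \<Rightarrow> 'a"
  assumes "compact (UNIV :: 'a set)" "continuous_on UNIV f" "0 < e"
  shows "0 < span_num f n e"
proof -
  obtain S :: "'a set" where "finite S" "card S = span_num f n e" "S \<noteq> {}"
    using span_num_attained[OF assms, of n] by blast
  then show ?thesis by (metis card_gt_0_iff)
qed

lemma span_num_antimono:
  fixes f :: "'a::metric_space \<Rightarrow> 'a"
  assumes "compact (UNIV :: 'a set)" "continuous_on UNIV f" "0 < e" "e \<le> e'"
  shows "span_num f n e' \<le> span_num f n e"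
proof -
  obtain S where "finite S" and S: "\<And>x. \<exists>y\<in>S. dn f n x y < e" and c: "card S = span_num f n e"
    using span_num_attained[OF assms(1-3), of n] by metis
  have "\<exists>y\<in>S. dn f n x y < e'" for x
    using S[of x] \<open>e \<le> e'\<close> by (meson less_le_trans)
  then show ?thesis using span_num_le[OF \<open>finite S\<close>] c by metis
qed

text \<open>In a separated set of largest cardinality no point can be added, so the set also spans
  at the same scale \<open>e\<close>. A largest one exists because each point of a finite
  \<open>e / 2\<close>-spanning set is near at most one separated point.\<close>

lemma separated_set:
  fixes f :: "'a::metric_space \<Rightarrow> 'a"
  assumes "compact (UNIV :: 'a set)" "continuous_on UNIV f" "0 < e"
  obtains S where "finite S" "\<And>x y. x \<in> S \<Longrightarrow> y \<in> S \<Longrightarrow> x \<noteq> y \<Longrightarrow> e \<le> dn f n x y"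
    "span_num f n e \<le> card S"
proof -
  define sep where "sep S \<longleftrightarrow> finite S \<and> (\<forall>x\<in>S. \<forall>y\<in>S. x \<noteq> y \<longrightarrow> e \<le> dn f n x y)" for S
  have "0 < e / 2" using assms(3) by simp
  from finite_spanning_set[OF assms(1,2) this, of n]
  obtain T where T: "finite T" "\<And>x. \<exists>y\<in>T. dn f n x y < e / 2" by blast
  have bound: "card S \<le> card T" if "sep S" for S
  proof -
    obtain g where g: "\<And>x. g x \<in> T" "\<And>x. dn f n x (g x) < e / 2"
      using T(2) by metis
    have "inj_on g S"
    proof (rule inj_onI, rule ccontr)
      fix x y assume xy: "x \<in> S" "y \<in> S" "g x = g y" "x \<noteq> y"
      have "dn f n x y < e"
        using dn_triangle[of f n x y "g x"] g(2)[of x] g(2)[of y] xy(3)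
          dn_commute[of f n y "g y"] by simp
      with xy \<open>sep S\<close> show False by (force simp: sep_def)
    qed
    then show ?thesis using g(1) \<open>finite T\<close> by (metis card_inj_on_le image_subsetI)
  qed
  have "sep {}" by (simp add: sep_def)
  then have "\<exists>S. sep S \<and> (\<forall>S'. sep S' \<longrightarrow> card S' \<le> card S)"
    using ex_has_greatest_nat[of sep "{}" card "Suc (card T)"] bound by (simp add: less_Suc_eq_le)
  then obtain S where S: "sep S" and mx: "\<And>S'. sep S' \<Longrightarrow> card S' \<le> card S" by blast
  have "\<exists>y\<in>S. dn f n x y < e" for x
  proof (rule ccontr)
    assume neg: "\<not> (\<exists>y\<in>S. dn f n x y < e)"
    then have "x \<notin> S" using dn_refl[of f n x] \<open>0 < e\<close> by auto
    have "e \<le> dn f n x y \<and> e \<le> dn f n y x" if "y \<in> S" for y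
      using neg that dn_commute[of f n x y] by (metis not_less)
    then have "sep (insert x S)" using S by (simp add: sep_def)
    then show False using mx[of "insert x S"] S \<open>x \<notin> S\<close> by (simp add: sep_def)
  qed
  then show ?thesis
    using S by (intro that[of S] span_num_le) (auto simp: sep_def)
qed

subsection \<open>Covering numbers of the hyperspace\<close>

lemma mem_nbhd_n_iff:
  assumes "A \<noteq> {}"
  shows "x \<in> nbhd_n f n e A \<longleftrightarrow> (\<exists>a\<in>A. dn f n x a < e)"
  unfolding nbhd_n_def dn_set_def mem_Collect_eq
  by (rule cInf_less_iff[of "dn f n x ` A" e, simplified])
    (use assms dn_nonneg in \<open>auto intro!: bdd_belowI2[where m = 0]\<close>)

lemma Hn_le:
  assumes "B \<noteq> {}" "C \<noteq> {}" "0 < e"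
    and "\<And>x. x \<in> B \<Longrightarrow> \<exists>y\<in>C. dn f n x y < e" "\<And>y. y \<in> C \<Longrightarrow> \<exists>x\<in>B. dn f n x y < e"
  shows "Hn f n B C \<le> e"
  unfolding Hn_def
proof (rule cInf_lower)
  show "e \<in> {e. 0 < e \<and> B \<subseteq> nbhd_n f n e C \<and> C \<subseteq> nbhd_n f n e B}"
    using assms
    by (simp add: subset_iff mem_nbhd_n_iff[OF assms(1)] mem_nbhd_n_iff[OF assms(2)] dn_commute)
qed (rule bdd_belowI[of _ 0], auto)

lemma Hn_less_imp_close:
  fixes f :: "'a::metric_space \<Rightarrow> 'a"
  assumes "compact (UNIV :: 'a set)" "B \<noteq> {}" "C \<noteq> {}" "Hn f n B C < e"
  shows "\<forall>x\<in>B. \<exists>y\<in>C. dn f n x y < e" and "\<forall>y\<in>C. \<exists>x\<in>B. dn f n y x < e"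
proof -
  obtain D where D: "0 < D" "\<And>n x y. dn f n x y < D"
    using dn_bounded[OF assms(1)] by blast
  let ?E = "{e. 0 < e \<and> B \<subseteq> nbhd_n f n e C \<and> C \<subseteq> nbhd_n f n e B}"
  \<comment> \<open>The uniform bound \<open>D\<close> keeps the set nonempty, so its infimum is no
    default value. The strict inequality then yields an admissible \<open>r < e\<close> even if the
    infimum is not attained.\<close>
  have "D \<in> ?E" using assms(2,3) D by (simp add: subset_iff mem_nbhd_n_iff ex_in_conv)
  then obtain r where r: "r \<in> ?E" "r < e"
    using cInf_lessD[of ?E e] assms(4) unfolding Hn_def by blast
  show "\<forall>x\<in>B. \<exists>y\<in>C. dn f n x y < e"
  proof
    fix x assume "x \<in> B"
    then have "x \<in> nbhd_n f n r C" using r by blast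
    then show "\<exists>y\<in>C. dn f n x y < e"
      using r(2) by (auto simp: mem_nbhd_n_iff[OF assms(3)] intro: less_trans)
  qed
  show "\<forall>x\<in>C. \<exists>y\<in>B. dn f n x y < e"
  proof
    fix x assume "x \<in> C"
    then have "x \<in> nbhd_n f n r B" using r by blast
    then show "\<exists>y\<in>B. dn f n x y < e"
      using r(2) by (auto simp: mem_nbhd_n_iff[OF assms(2)] intro: less_trans)
  qed
qed

text \<open>At scale \<open>e\<close>, a member of \<open>Z\<close> is described by those points of
  a minimal spanning set that lie near it, so the nonempty subsets of the spanning set form a
  net.\<close>

lemma finite_hyperspace_cover:
  fixes f :: "'a::metric_space \<Rightarrow> 'a"
  assumes "compact (UNIV :: 'a set)" "continuous_on UNIV f" "0 < e" "Z \<subseteq> hyperspace"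
  obtains G where "G \<subseteq> hyperspace" "finite G" "\<forall>B\<in>Z. \<exists>C\<in>G. Hn f n B C \<le> e"
    "card G \<le> 2 ^ span_num f n e"
proof -
  obtain S where S: "finite S" "\<And>x. \<exists>y\<in>S. dn f n x y < e" and c: "card S = span_num f n e"
    using span_num_attained[OF assms(1-3), of n] by metis
  show ?thesis
  proof (rule that[of "Pow S - {{}}"])
    show "Pow S - {{}} \<subseteq> hyperspace"
      using \<open>finite S\<close> by (auto simp: hyperspace_def intro: finite_imp_closed finite_subset)
    show "finite (Pow S - {{}})" using \<open>finite S\<close> by simp
    show "card (Pow S - {{}}) \<le> 2 ^ span_num f n e"
      using card_mono[of "Pow S" "Pow S - {{}}"] \<open>finite S\<close> c by (auto simp: card_Pow)
    show "\<forall>B\<in>Z. \<exists>C\<in>Pow S - {{}}. Hn f n B C \<le> e"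
    proof
      fix B assume "B \<in> Z"
      then have "B \<noteq> {}" using assms(4) by (auto simp: hyperspace_def)
      let ?C = "{y \<in> S. \<exists>x\<in>B. dn f n x y < e}"
      have "?C \<noteq> {}" using \<open>B \<noteq> {}\<close> S(2) by blast
      moreover have "Hn f n B ?C \<le> e"
        using \<open>B \<noteq> {}\<close> \<open>?C \<noteq> {}\<close> \<open>0 < e\<close> S(2) by (intro Hn_le) blast+
      ultimately show "\<exists>C\<in>Pow S - {{}}. Hn f n B C \<le> e" by blast
    qed
  qed
qed

lemma NK_le_power_span_num:
  fixes f :: "'a::metric_space \<Rightarrow> 'a"
  assumes "compact (UNIV :: 'a set)" "continuous_on UNIV f" "0 < e" "Z \<subseteq> hyperspace"
  shows "NK f Z n e \<le> 2 ^ span_num f n e"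
proof -
  obtain G where G: "G \<subseteq> hyperspace" "finite G" "\<forall>B\<in>Z. \<exists>C\<in>G. Hn f n B C \<le> e"
    "card G \<le> 2 ^ span_num f n e"
    using finite_hyperspace_cover[OF assms, of n] by metis
  have "NK f Z n e \<le> card G"
    unfolding NK_def by (rule cInf_lower) (use G in blast, rule bdd_below_bot)
  with G(4) show ?thesis by linarith
qed

lemma NK_attained:
  fixes f :: "'a::metric_space \<Rightarrow> 'a"
  assumes "compact (UNIV :: 'a set)" "continuous_on UNIV f" "0 < e" "Z \<subseteq> hyperspace"
  obtains G where "G \<subseteq> hyperspace" "finite G" "\<forall>B\<in>Z. \<exists>C\<in>G. Hn f n B C \<le> e"
    "card G = NK f Z n e"
proof -
  let ?A = "{card G | G. G \<subseteq> hyperspace \<and> finite G \<and> (\<forall>B\<in>Z. \<exists>C\<in>G. Hn f n B C \<le> e)}"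
  obtain G0 where "G0 \<subseteq> hyperspace" "finite G0" "\<forall>B\<in>Z. \<exists>C\<in>G0. Hn f n B C \<le> e"
    using finite_hyperspace_cover[OF assms, of n] by metis
  then have "?A \<noteq> {}" by blast
  then have "NK f Z n e \<in> ?A"
    unfolding NK_def by (rule Inf_nat_def1)
  then obtain G where "NK f Z n e = card G" "G \<subseteq> hyperspace" "finite G"
    "\<forall>B\<in>Z. \<exists>C\<in>G. Hn f n B C \<le> e" by blast
  then show ?thesis by (intro that[of G]) simp_all
qed

subsection \<open>Invariant sets generated by tracing points\<close>

lemma compact_nested_nonempty:
  fixes F :: "nat \<Rightarrow> 'a::t2_space set"
  assumes "\<And>k. compact (F k)" "\<And>k. F k \<noteq> {}" "\<And>j k. j \<le> k \<Longrightarrow> F k \<subseteq> F j"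
  shows "\<Inter>(range F) \<noteq> {}"
proof -
  have "F 0 \<inter> \<Inter>(F ` UNIV) \<noteq> {}"
  proof (rule compact_imp_fip_image)
    fix I :: "nat set" assume "finite I"
    then have "F (Max (insert 0 I)) \<subseteq> F 0 \<inter> \<Inter>(F ` I)"
      by (intro Int_greatest INF_greatest assms(3)) auto
    then show "F 0 \<inter> \<Inter>(F ` I) \<noteq> {}" using assms(2) by blast
  qed (use assms(1) compact_imp_closed in auto)
  then show ?thesis by blast
qed

text \<open>Compactness gives the inclusion from right to left: for \<open>y\<close> in the core,
  its preimages under \<open>f\<close> within the successive images of \<open>W\<close> are nested,
  nonempty and compact, and a common point of them is a preimage in the core.\<close>

lemma invariant_core:
  fixes f :: "'a::t2_space \<Rightarrow> 'a"
  assumes "compact W" "continuous_on UNIV f" "f ` W \<subseteq> W"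
  shows "f ` (\<Inter>k. (f^^k) ` W) = (\<Inter>k. (f^^k) ` W)"
proof (intro equalityI subsetI)
  fix y assume "y \<in> f ` (\<Inter>k. (f^^k) ` W)"
  then obtain x where x: "y = f x" "\<And>k. x \<in> (f^^k) ` W" by blast
  have "y \<in> (f^^k) ` W" for k
  proof (cases k)
    case 0
    then show ?thesis using x(1) x(2)[of 0] assms(3) by auto
  next
    case (Suc j)
    then show ?thesis using x(1) x(2)[of j] by auto
  qed
  then show "y \<in> (\<Inter>k. (f^^k) ` W)" by blast
next
  fix y assume y: "y \<in> (\<Inter>k. (f^^k) ` W)"
  define F where "F k = (f^^k) ` W \<inter> f -` {y}" for k
  have dec: "(f^^Suc k) ` W \<subseteq> (f^^k) ` W" for k
    using assms(3) by (auto simp: funpow_Suc_right simp del: funpow.simps)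
  have "\<Inter>(range F) \<noteq> {}"
  proof (rule compact_nested_nonempty)
    show "compact (F k)" for k
      unfolding F_def using assms
      by (intro compact_Int_closed compact_continuous_image continuous_on_funpow
          closed_vimage closed_singleton) auto
    show "F k \<noteq> {}" for k
    proof -
      have "y \<in> (f^^Suc k) ` W" using y by blast
      then show ?thesis by (auto simp: F_def)
    qed
    show "F k \<subseteq> F j" if "j \<le> k" for j k
      using lift_Suc_antimono_le[of "\<lambda>k. (f^^k) ` W", OF dec that] by (auto simp: F_def)
  qed
  then show "y \<in> f ` (\<Inter>k. (f^^k) ` W)" by (auto simp: F_def)
qed

text \<open>
  Only the first \<open>n\<close> steps of each block of length \<open>m\<close> are constrained; the other \<open>m - n\<close> are the gap.
\<close>

definition tracing :: "('a::metric_space \<Rightarrow> 'a) \<Rightarrow> nat \<Rightarrow> nat \<Rightarrow> real \<Rightarrow> 'a \<Rightarrow> 'a set" where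
  "tracing f n m e x = {y. \<forall>j. \<forall>i<n. dist ((f^^(j * m + i)) y) ((f^^i) x) \<le> e}"

lemma closed_dist_funpow_le:
  fixes f :: "'a::metric_space \<Rightarrow> 'a"
  assumes "continuous_on UNIV f"
  shows "closed {y. dist ((f^^i) y) a \<le> e}"
  by (intro closed_Collect_le continuous_intros continuous_on_funpow assms)

lemma compact_tracing:
  fixes f :: "'a::metric_space \<Rightarrow> 'a"
  assumes "compact (UNIV :: 'a set)" "continuous_on UNIV f"
  shows "compact (tracing f n m e x)"
proof -
  have "tracing f n m e x
      = (\<Inter>j. \<Inter>i\<in>{..<n}. {y. dist ((f^^(j * m + i)) y) ((f^^i) x) \<le> e})"
    by (auto simp: tracing_def)
  then have "closed (tracing f n m e x)"
    by (auto intro!: closed_INT closed_dist_funpow_le assms)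
  then show ?thesis
    using compact_Int_closed[OF assms(1)] by auto
qed

lemma funpow_tracing:
  assumes "y \<in> tracing f n m e x"
  shows "(f^^(k * m)) y \<in> tracing f n m e x"
proof -
  have "(f^^(j * m + i)) ((f^^(k * m)) y) = (f^^((j + k) * m + i)) y" for j i
    using funpow_add[of "j * m + i" "k * m" f]
    by (simp add: add.commute add.left_commute distrib_right)
  then show ?thesis using assms by (auto simp: tracing_def)
qed

text \<open>Specification handles finitely many blocks; the closed conditions for more and more
  blocks are nested, so compactness gives a point tracing forever. The gap \<open>s\<close> is fixed
  before \<open>n\<close> and \<open>x\<close>, which keeps the later counting linear in
  \<open>n\<close>.\<close>

lemma specification_tracing:
  fixes f :: "'a::metric_space \<Rightarrow> 'a"
  assumes "compact (UNIV :: 'a set)" "continuous_on UNIV f" "has_specification f" "0 < e"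
  obtains s where "0 < s" "\<And>n x. tracing f n (n + s) e x \<noteq> {}"
proof -
  obtain n0 where n0: "\<forall>(k::nat) (x::nat \<Rightarrow> 'a) (n::nat \<Rightarrow> nat) (s::nat \<Rightarrow> nat).
      (\<forall>i\<in>{1..k}. s i \<ge> n0) \<longrightarrow>
      (\<exists>p. \<forall>j\<in>{1..k}. \<forall>i<n j.
          dist ((f^^((\<Sum>l=1..j-1. n l + s l) + i)) p) ((f^^i) (x j)) < e)"
    using assms(3)[unfolded has_specification_def, rule_format, OF assms(4)] ..
  \<comment> \<open>\<open>Suc\<close> makes the period \<open>n + s\<close> positive even for
    \<open>n = 0\<close>.\<close>
  define s where "s = Suc n0"
  have "tracing f n (n + s) e x \<noteq> {}" for n x
  proof -
    define F where
      "F k = (\<Inter>j\<in>{..<k}. \<Inter>i\<in>{..<n}. {y. dist ((f^^(j * (n + s) + i)) y) ((f^^i) x) \<le> e})"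
      for k :: nat
    have "\<Inter>(range F) \<noteq> {}"
    proof (rule compact_nested_nonempty)
      have "closed (F k)" for k
        unfolding F_def by (auto intro!: closed_INT closed_dist_funpow_le assms)
      then show "compact (F k)" for k
        using compact_Int_closed[OF assms(1), of "F k"] by auto
      show "F k \<noteq> {}" for k
      proof -
        obtain p where p: "\<forall>j\<in>{1..k}. \<forall>i<n.
            dist ((f^^((\<Sum>l=1..j-1. n + s) + i)) p) ((f^^i) x) < e"
          using n0[THEN spec[of _ k], THEN spec[of _ "\<lambda>_. x"], THEN spec[of _ "\<lambda>_. n"],
              THEN spec[of _ "\<lambda>_. s"]] by (auto simp: s_def)
        \<comment> \<open>The specification property numbers blocks from 1, here they start at 0;
          its block \<open>Suc j\<close> begins at time \<open>j * (n + s)\<close>.\<close>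
        have "dist ((f^^(j * (n + s) + i)) p) ((f^^i) x) \<le> e" if "j < k" "i < n" for i j
          using p[rule_format, of "Suc j" i] that by simp
        then have "p \<in> F k" by (auto simp: F_def)
        then show ?thesis by blast
      qed
      show "F k \<subseteq> F j" if "j \<le> k" for j k
        using that by (force simp: F_def)
    qed
    then obtain y where "\<And>k. y \<in> F k" by blast
    then have "y \<in> tracing f n (n + s) e x"
      unfolding tracing_def F_def by blast
    then show ?thesis by blast
  qed
  then show ?thesis using that[of s] by (auto simp: s_def)
qed

text \<open>Since \<open>f^^m\<close> maps the tracing set into itself, its iterates of order below
  \<open>m\<close> form a compact forward invariant \<open>W\<close>, and \<open>B\<close> is the
  invariant core of \<open>W\<close>.\<close>

lemma invariant_set_near_orbit_segment:
  fixes f :: "'a::metric_space \<Rightarrow> 'a"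
  assumes "compact (UNIV :: 'a set)" "continuous_on UNIV f" "0 < m"
    and "tracing f n m e x \<noteq> {}"
  obtains B where "B \<in> inv_hyperspace f" "B \<inter> tracing f n m e x \<noteq> {}"
    "B \<subseteq> (\<Union>i<m. (f^^i) ` tracing f n m e x)"
proof -
  let ?Y = "tracing f n m e x"
  define W where "W = (\<Union>i<m. (f^^i) ` ?Y)"
  define B where "B = (\<Inter>k. (f^^k) ` W)"
  have compW: "compact W"
    unfolding W_def
    by (intro compact_UN compact_continuous_image continuous_on_funpow assms compact_tracing) auto
  have fW: "f ` W \<subseteq> W"
  proof
    fix w assume "w \<in> f ` W"
    then obtain i y where iy: "i < m" "y \<in> ?Y" "w = (f^^Suc i) y"
      by (auto simp: W_def)
    show "w \<in> W"
    proof (cases "Suc i < m")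
      case True
      then show ?thesis using iy by (auto simp: W_def simp del: funpow.simps)
    next
      case False
      then have "Suc i = m" using iy(1) by simp
      then have "w \<in> ?Y" using iy funpow_tracing[OF iy(2), of 1] by simp
      then show ?thesis using \<open>0 < m\<close> by (force simp: W_def)
    qed
  qed
  have dec: "(f^^Suc k) ` W \<subseteq> (f^^k) ` W" for k
    using fW by (auto simp: funpow_Suc_right simp del: funpow.simps)
  have decm: "(f^^k) ` W \<subseteq> (f^^j) ` W" if "j \<le> k" for j k
    using lift_Suc_antimono_le[of "\<lambda>k. (f^^k) ` W", OF dec that] .
  \<comment> \<open>\<open>B\<close> has to meet the tracing set itself, not merely be nonempty. The
    images of \<open>?Y\<close> under \<open>f^^(k * m)\<close> are nested inside \<open>?Y\<close>,
    and \<open>k <= k * m\<close> carries their common point \<open>z\<close> into every image of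
    \<open>W\<close>.\<close>
  have "\<Inter>(range (\<lambda>k. (f^^(k * m)) ` ?Y)) \<noteq> {}"
  proof (rule compact_nested_nonempty)
    show "compact ((f^^(k * m)) ` ?Y)" for k
      by (intro compact_continuous_image continuous_on_funpow assms compact_tracing)
    show "(f^^(k * m)) ` ?Y \<noteq> {}" for k using assms(4) by simp
    show "(f^^(k * m)) ` ?Y \<subseteq> (f^^(j * m)) ` ?Y" if "j \<le> k" for j k
    proof
      fix w assume "w \<in> (f^^(k * m)) ` ?Y"
      then obtain y where y: "y \<in> ?Y" "w = (f^^(k * m)) y" by blast
      have "w = (f^^(j * m)) ((f^^((k - j) * m)) y)"
        using y(2) that funpow_add[of "j * m" "(k - j) * m" f]
        by (simp flip: distrib_right)
      then show "w \<in> (f^^(j * m)) ` ?Y" using funpow_tracing[OF y(1)] by blast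
    qed
  qed
  then obtain z where z: "\<And>k. z \<in> (f^^(k * m)) ` ?Y" by blast
  have "?Y \<subseteq> W" using \<open>0 < m\<close> by (force simp: W_def)
  have "z \<in> (f^^k) ` W" for k
  proof -
    have "k \<le> k * m" using \<open>0 < m\<close> by simp
    from decm[OF this] show ?thesis using z[of k] \<open>?Y \<subseteq> W\<close> by blast
  qed
  then have "z \<in> B" by (auto simp: B_def)
  moreover have "z \<in> ?Y" using z[of 0] by simp
  moreover have "closed B"
    unfolding B_def
    by (intro closed_INT ballI compact_imp_closed compact_continuous_image
        continuous_on_funpow assms compW)
  moreover have "f ` B = B"
    unfolding B_def by (rule invariant_core[OF compW assms(2) fW])
  moreover have "B \<subseteq> W" using INT_lower[of 0 UNIV "\<lambda>k. (f^^k) ` W"] by (simp add: B_def)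
  ultimately show ?thesis
    by (intro that[of B]) (auto simp: inv_hyperspace_def hyperspace_def W_def)
qed

text \<open>A point of \<open>S\<close> near \<open>B\<close> is encoded by a phase below
  \<open>n + s\<close> and a point of \<open>P\<close> shadowing the gap, which starts at time
  \<open>n\<close>. Equal codes put two points of \<open>S\<close> within
  \<open>2 * d + 2 * e < r\<close>, so the encoding is injective.\<close>

lemma card_near_invariant_set_le:
  assumes "finite S" and sep: "\<And>x y. x \<in> S \<Longrightarrow> y \<in> S \<Longrightarrow> x \<noteq> y \<Longrightarrow> r \<le> dn f n x y"
    and "2 * d + 2 * e < r" "0 \<le> e"
    and "finite P" and P: "\<And>x. \<exists>y\<in>P. dn f s x y < e"
    and B: "B \<subseteq> (\<Union>i<n + s. (f^^i) ` tracing f n (n + s) e w)"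
  shows "card {x \<in> S. \<exists>b\<in>B. dn f n x b < d} \<le> (n + s) * card P"
proof -
  let ?Y = "tracing f n (n + s) e w"
  define A where "A = {x \<in> S. \<exists>b\<in>B. dn f n x b < d}"
  have "\<forall>x\<in>A. \<exists>i z t. i < n + s \<and> z \<in> ?Y \<and> t \<in> P \<and> dn f n x ((f^^i) z) < d
      \<and> dn f s ((f^^n) z) t < e"
  proof
    fix x assume "x \<in> A"
    then obtain b where b: "b \<in> B" "dn f n x b < d" by (auto simp: A_def)
    then obtain i z where iz: "i < n + s" "z \<in> ?Y" "b = (f^^i) z" using B by blast
    obtain t where "t \<in> P" "dn f s ((f^^n) z) t < e" using P by blast
    with b(2) iz show "\<exists>i z t. i < n + s \<and> z \<in> ?Y \<and> t \<in> P \<and> dn f n x ((f^^i) z) < d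
      \<and> dn f s ((f^^n) z) t < e" by blast
  qed
  then obtain i z t where izt: "\<And>x. x \<in> A \<Longrightarrow> i x < n + s \<and> z x \<in> ?Y \<and> t x \<in> P
      \<and> dn f n x ((f^^i x) (z x)) < d \<and> dn f s ((f^^n) (z x)) (t x) < e"
    by metis
  \<comment> \<open>A window of length \<open>n\<close> starting at a phase below
    \<open>n + s\<close> ends before time \<open>(n + s) + n\<close> and can meet only the first
    gap. In the two blocks both orbits are compared with that of \<open>w\<close>, in the gap with
    that of the common point \<open>t x\<close>.\<close>
  have close: "dist ((f^^k) (z x)) ((f^^k) (z y)) \<le> 2 * e"
    if xy: "x \<in> A" "y \<in> A" "t x = t y" and k: "k < (n + s) + n" for x y k
  proof -
    have Y: "z x \<in> ?Y" "z y \<in> ?Y" using izt xy by blast+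
    have tr: "dist ((f^^(j * (n + s) + l)) (z x)) ((f^^(j * (n + s) + l)) (z y)) \<le> 2 * e"
      if "l < n" for j l
    proof -
      have "dist ((f^^(j * (n + s) + l)) (z x)) ((f^^l) w) \<le> e"
        "dist ((f^^(j * (n + s) + l)) (z y)) ((f^^l) w) \<le> e"
        using Y that by (auto simp: tracing_def)
      then show ?thesis
        using dist_triangle2[of "(f^^(j * (n + s) + l)) (z x)" "(f^^(j * (n + s) + l)) (z y)"
            "(f^^l) w"] by linarith
    qed
    consider "k < n" | "n \<le> k" "k < n + s" | "n + s \<le> k" by linarith
    then show ?thesis
    proof cases
      case 1
      then show ?thesis using tr[of k 0] by simp
    next
      case 2
      have "dn f s ((f^^n) (z x)) (t x) < e" "dn f s (t x) ((f^^n) (z y)) < e"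
        using izt[OF xy(1)] izt[OF xy(2)] xy(3) by (simp_all add: dn_commute[of f s "t y"])
      then have "dn f s ((f^^n) (z x)) ((f^^n) (z y)) \<le> 2 * e"
        using dn_triangle[of f s "(f^^n) (z x)" "(f^^n) (z y)" "t x"] by linarith
      then have "dist ((f^^(k - n)) ((f^^n) (z x))) ((f^^(k - n)) ((f^^n) (z y))) \<le> 2 * e"
        using 2 by (auto simp: dn_le_iff)
      then show ?thesis
        using 2 funpow_add[of "k - n" n f] by simp
    next
      case 3
      then show ?thesis using tr[of "k - (n + s)" 1] k by simp
    qed
  qed
  have "inj_on (\<lambda>x. (i x, t x)) A"
  proof (rule inj_onI, rule ccontr)
    fix x y assume xy: "x \<in> A" "y \<in> A" "(i x, t x) = (i y, t y)" "x \<noteq> y"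
    have "dist ((f^^k) ((f^^i x) (z x))) ((f^^k) ((f^^i y) (z y))) \<le> 2 * e" if "k < n" for k
      using close[OF xy(1,2), of "k + i x"] xy(3) izt[OF xy(1)] that
      by (simp add: funpow_add)
    then have "dn f n ((f^^i x) (z x)) ((f^^i y) (z y)) \<le> 2 * e"
      using \<open>0 \<le> e\<close> by (auto simp: dn_le_iff)
    moreover have "dn f n x ((f^^i x) (z x)) < d" "dn f n y ((f^^i y) (z y)) < d"
      using izt xy by blast+
    ultimately have "dn f n x y < r"
      using dn_triangle[of f n x y "(f^^i x) (z x)"]
        dn_triangle[of f n "(f^^i x) (z x)" y "(f^^i y) (z y)"]
        dn_commute[of f n y "(f^^i y) (z y)"] assms(3) by linarith
    with sep[of x y] xy show False by (auto simp: A_def)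
  qed
  moreover have "(\<lambda>x. (i x, t x)) ` A \<subseteq> {..<n + s} \<times> P" using izt by blast
  ultimately have "card A \<le> card ({..<n + s} \<times> P)"
    using \<open>finite P\<close> by (intro card_inj_on_le) auto
  then show ?thesis by (simp add: card_cartesian_product A_def)
qed

subsection \<open>Separated families of invariant sets\<close>

text \<open>Out-degrees and in-degrees have the same sum, so some vertex has out-degree at most
  \<open>D\<close>. Keep it, discard its neighbours in both directions, which removes at most
  \<open>2 * D + 1\<close> vertices in all, and induct.\<close>

lemma independent_subset_bounded_indegree:
  assumes "finite S" "\<And>y. y \<in> S \<Longrightarrow> card {x \<in> S. R x y} \<le> D"
  obtains T where "T \<subseteq> S" "\<And>x y. x \<in> T \<Longrightarrow> y \<in> T \<Longrightarrow> x \<noteq> y \<Longrightarrow> \<not> R x y"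
    "card S \<le> (2 * D + 1) * card T"
proof -
  have "\<exists>T\<subseteq>S. (\<forall>x\<in>T. \<forall>y\<in>T. x \<noteq> y \<longrightarrow> \<not> R x y) \<and> card S \<le> (2 * D + 1) * card T"
    using assms
  proof (induction S rule: finite_psubset_induct)
    case (psubset S)
    show ?case
    proof (cases "S = {}")
      case False
      have "\<exists>v\<in>S. card {y \<in> S. R v y} \<le> D"
      proof (rule ccontr)
        assume "\<not> ?thesis"
        then have "(\<Sum>v\<in>S. D) < (\<Sum>v\<in>S. card {y \<in> S. R v y})"
          using psubset.hyps False by (intro sum_strict_mono) (auto simp: not_le)
        also have "\<dots> = (\<Sum>v\<in>S. \<Sum>y | y \<in> S \<and> R v y. 1)" by simp
        also have "\<dots> = (\<Sum>y\<in>S. \<Sum>v | v \<in> S \<and> R v y. 1)"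
          by (rule sum.swap_restrict[OF psubset.hyps psubset.hyps])
        also have "\<dots> = (\<Sum>y\<in>S. card {x \<in> S. R x y})" by simp
        also have "\<dots> \<le> (\<Sum>y\<in>S. D)" using psubset.prems by (rule sum_mono)
        finally show False by simp
      qed
      then obtain v where v: "v \<in> S" "card {y \<in> S. R v y} \<le> D" by blast
      define N where "N = insert v ({y \<in> S. R v y} \<union> {x \<in> S. R x v})"
      have "N \<subseteq> S" "finite N" using v psubset.hyps by (auto simp: N_def)
      have "card N \<le> 1 + card ({y \<in> S. R v y} \<union> {x \<in> S. R x v})"
        unfolding N_def by (simp add: card_insert_if psubset.hyps)
      also have "\<dots> \<le> 1 + (card {y \<in> S. R v y} + card {x \<in> S. R x v})"
        using card_Un_le by simp
      also have "\<dots> \<le> 2 * D + 1" using v psubset.prems[OF v(1)] by simp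
      finally have cN: "card N \<le> 2 * D + 1" .
      have "S - N \<subset> S" using v by (auto simp: N_def)
      moreover have "card {x \<in> S - N. R x y} \<le> D" if "y \<in> S - N" for y
      proof -
        have "card {x \<in> S - N. R x y} \<le> card {x \<in> S. R x y}"
          using psubset.hyps by (intro card_mono) auto
        then show ?thesis using psubset.prems[of y] that by simp
      qed
      ultimately obtain T where T: "T \<subseteq> S - N" "\<forall>x\<in>T. \<forall>y\<in>T. x \<noteq> y \<longrightarrow> \<not> R x y"
        "card (S - N) \<le> (2 * D + 1) * card T"
        using psubset.IH[of "S - N"] by blast
      have "v \<notin> T" "finite T" using T(1) psubset.hyps finite_subset by (auto simp: N_def)
      have "card S = card (S - N) + card N"
        using \<open>N \<subseteq> S\<close> psubset.hyps \<open>finite N\<close>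
        by (metis card_Diff_subset card_mono le_add_diff_inverse2)
      also have "\<dots> \<le> (2 * D + 1) * card (insert v T)"
        using T(3) cN \<open>v \<notin> T\<close> \<open>finite T\<close> by simp
      finally have "card S \<le> (2 * D + 1) * card (insert v T)" .
      moreover have "\<forall>x\<in>insert v T. \<forall>y\<in>insert v T. x \<noteq> y \<longrightarrow> \<not> R x y"
        using T(1,2) by (auto simp: N_def)
      ultimately show ?thesis using T(1) v(1) by (intro exI[of _ "insert v T"]) auto
    qed auto
  qed
  then show ?thesis using that by blast
qed

lemma Union_in_inv_hyperspace:
  assumes "finite A" "A \<noteq> {}" "\<And>x. x \<in> A \<Longrightarrow> B x \<in> inv_hyperspace f"
  shows "\<Union>(B ` A) \<in> inv_hyperspace f"
proof -
  have "f ` \<Union>(B ` A) = \<Union>(B ` A)"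
    using assms(3) by (auto simp: inv_hyperspace_def image_UN)
  then show ?thesis
    using assms by (auto simp: inv_hyperspace_def hyperspace_def intro!: closed_UN)
qed

text \<open>The scales fit because \<open>r/8 + r/16 + r/16 = r/4\<close> (tracing and two passages
  through the net) and \<open>2 * (r/4) + 2 * (r/8) < r\<close> (counting). The \<open>+ 1\<close>
  pays for the empty subset of \<open>T\<close>. Both \<open>s\<close> and \<open>K\<close> are
  chosen before \<open>n\<close> and \<open>e\<close>.\<close>

lemma span_num_NK_lower_bound:
  fixes f :: "'a::metric_space \<Rightarrow> 'a"
  assumes comp: "compact (UNIV :: 'a set)" and cont: "continuous_on UNIV f"
    and spec: "has_specification f" and "0 < r"
  obtains s K :: nat where "\<And>n e. 0 < e \<Longrightarrow> e < r / 16 \<Longrightarrow>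
       \<exists>k. span_num f n r \<le> (2 * ((n + s) * K) + 1) * k \<and> 2 ^ k \<le> NK f (inv_hyperspace f) n e + 1"
proof -
  have "0 < r / 8" using \<open>0 < r\<close> by simp
  obtain s where s: "0 < s" "\<And>n x. tracing f n (n + s) (r / 8) x \<noteq> {}"
    using specification_tracing[OF comp cont spec \<open>0 < r / 8\<close>] by blast
  obtain P where P: "finite P" "\<And>x. \<exists>y\<in>P. dn f s x y < r / 8"
    using finite_spanning_set[OF comp cont \<open>0 < r / 8\<close>, of s] by metis
  show ?thesis
  proof (rule that[of s "card P"])
    fix n :: nat and e :: real
    assume e: "0 < e" "e < r / 16"
    obtain S where S: "finite S" "\<And>x y. x \<in> S \<Longrightarrow> y \<in> S \<Longrightarrow> x \<noteq> y \<Longrightarrow> r \<le> dn f n x y"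
      "span_num f n r \<le> card S"
      using separated_set[OF comp cont \<open>0 < r\<close>, of n] by metis
    have "\<exists>B. B \<in> inv_hyperspace f \<and> B \<inter> tracing f n (n + s) (r / 8) x \<noteq> {}
        \<and> B \<subseteq> (\<Union>i<n + s. (f^^i) ` tracing f n (n + s) (r / 8) x)" for x
      using invariant_set_near_orbit_segment[OF comp cont _ s(2), of n x] s(1)
      by (metis add_gr_0)
    then obtain B where B: "\<And>x. B x \<in> inv_hyperspace f"
      "\<And>x. B x \<inter> tracing f n (n + s) (r / 8) x \<noteq> {}"
      "\<And>x. B x \<subseteq> (\<Union>i<n + s. (f^^i) ` tracing f n (n + s) (r / 8) x)"
      by metis
    \<comment> \<open>The arrow points from \<open>x\<close> to the \<open>y\<close> whose invariant
      set comes near \<open>x\<close>, so the counting lemma bounds in-degrees.\<close>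
    define R where "R x y \<longleftrightarrow> (\<exists>b\<in>B y. dn f n x b < r / 4)" for x y
    have "card {x \<in> S. R x y} \<le> (n + s) * card P" for y
      unfolding R_def
      by (rule card_near_invariant_set_le[OF S(1,2) _ _ P B(3)]) (use \<open>0 < r\<close> in auto)
    then obtain T where T: "T \<subseteq> S" "\<And>x y. x \<in> T \<Longrightarrow> y \<in> T \<Longrightarrow> x \<noteq> y \<Longrightarrow> \<not> R x y"
      "card S \<le> (2 * ((n + s) * card P) + 1) * card T"
      using independent_subset_bounded_indegree[OF S(1), of R "(n + s) * card P"] by metis
    have "finite T" using T(1) S(1) finite_subset by blast
    have "inv_hyperspace f \<subseteq> hyperspace" by (auto simp: inv_hyperspace_def)
    from NK_attained[OF comp cont e(1) this, of n]
    obtain G where G: "G \<subseteq> hyperspace" "finite G"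
      "\<forall>B\<in>inv_hyperspace f. \<exists>C\<in>G. Hn f n B C \<le> e"
      "card G = NK f (inv_hyperspace f) n e"
      by metis
    let ?F = "Pow T - {{}}"
    have inv: "\<Union>(B ` A) \<in> inv_hyperspace f" if "A \<in> ?F" for A
      using that \<open>finite T\<close> B(1) by (intro Union_in_inv_hyperspace) (auto intro: finite_subset)
    have "\<forall>A\<in>?F. \<exists>C\<in>G. Hn f n (\<Union>(B ` A)) C \<le> e"
      using G(3) inv by blast
    then obtain g where g: "\<And>A. A \<in> ?F \<Longrightarrow> g A \<in> G \<and> Hn f n (\<Union>(B ` A)) (g A) \<le> e"
      by metis
    \<comment> \<open>This gives injectivity of \<open>g\<close>. If \<open>x\<close> is in
      \<open>A\<close> but not in \<open>A'\<close>, a tracing point of \<open>B x\<close> is linked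
      through the shared net element to some \<open>B x'\<close> with \<open>x'\<close> in
      \<open>A'\<close>, which is a forbidden arrow within \<open>T\<close>.\<close>
    have sub: "A \<subseteq> A'" if AA': "A \<in> ?F" "A' \<in> ?F" "g A = g A'" for A A'
    proof
      fix x assume "x \<in> A"
      show "x \<in> A'"
      proof (rule ccontr)
        assume "x \<notin> A'"
        have ne: "\<Union>(B ` A) \<noteq> {}" "\<Union>(B ` A') \<noteq> {}" "g A \<noteq> {}"
          using inv[OF AA'(1)] inv[OF AA'(2)] g[OF AA'(1)] G(1)
          by (auto simp: inv_hyperspace_def hyperspace_def)
        have lt: "Hn f n (\<Union>(B ` A)) (g A) < r / 16" "Hn f n (\<Union>(B ` A')) (g A) < r / 16"
          using g[OF AA'(1)] g[OF AA'(2)] AA'(3) e(2) by auto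
        obtain z where z: "z \<in> B x" "z \<in> tracing f n (n + s) (r / 8) x" using B(2) by blast
        have "dist ((f^^i) x) ((f^^i) z) \<le> r / 8" if "i < n" for i
          using z(2) that unfolding tracing_def mem_Collect_eq
          by (metis add_0 dist_commute mult_0)
        then have d1: "dn f n x z \<le> r / 8" using \<open>0 < r\<close> unfolding dn_le_iff by simp
        obtain c where c: "c \<in> g A" "dn f n z c < r / 16"
          using Hn_less_imp_close(1)[OF comp ne(1,3) lt(1)] z(1) \<open>x \<in> A\<close> by blast
        obtain x' b where b: "x' \<in> A'" "b \<in> B x'" "dn f n c b < r / 16"
          using Hn_less_imp_close(2)[OF comp ne(2,3) lt(2)] c(1) by blast
        have "dn f n x b < r / 4"
          using dn_triangle[of f n x b z] dn_triangle[of f n z b c] d1 c(2) b(3) by linarith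
        then have "R x x'" using b(2) by (auto simp: R_def)
        moreover have "x \<in> T" "x' \<in> T" "x \<noteq> x'"
          using AA' \<open>x \<in> A\<close> \<open>x \<notin> A'\<close> b(1) by auto
        ultimately show False using T(2) by blast
      qed
    qed
    have "inj_on g ?F" by (rule inj_onI) (use sub in \<open>metis subset_antisym\<close>)
    then have "card ?F \<le> card G"
      by (rule card_inj_on_le) (use g G(2) in auto)
    moreover have "card ?F = 2 ^ card T - 1"
      using \<open>finite T\<close> by (simp add: card_Pow)
    ultimately have "2 ^ card T \<le> NK f (inv_hyperspace f) n e + 1"
      using G(4) by simp
    moreover have "span_num f n r \<le> (2 * ((n + s) * card P) + 1) * card T"
      using S(3) T(3) by simp
    ultimately show "\<exists>k. span_num f n r \<le> (2 * ((n + s) * card P) + 1) * k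
        \<and> 2 ^ k \<le> NK f (inv_hyperspace f) n e + 1" by blast
  qed
qed

subsection \<open>Growth rates\<close>

text \<open>For \<open>N <= 1\<close> the convention \<open>ln 0 = 0\<close> makes the left side 0;
  otherwise the factor \<open>ln 2 < 1\<close> is dropped.\<close>

lemma ln_ln_le_of_le_two_power:
  assumes "N \<le> 2 ^ m" "0 < m"
  shows "ln (ln (real N)) \<le> ln (real m)"
proof (cases "N \<le> 1")
  case True
  then have "N = 0 \<or> N = 1" by auto
  then show ?thesis using assms(2) by auto
next
  case False
  have "real N \<le> 2 ^ m" using assms(1) by (metis of_nat_le_iff of_nat_numeral of_nat_power)
  then have "ln (real N) \<le> ln (2 ^ m)" using False by (subst ln_le_cancel_iff) auto
  also have "\<dots> = real m * ln 2" by (simp add: ln_realpow)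
  also have "\<dots> \<le> real m * 1" using ln_2_less_1 by (intro mult_left_mono) auto
  finally show ?thesis using False by (simp add: assms(2))
qed

text \<open>For \<open>N > 1\<close> one has \<open>k / 4 <= ln N\<close>, and
  \<open>ln 4 = 2 * ln 2 < 2\<close> explains the loss of 2. For \<open>N <= 1\<close> only
  \<open>k = 1\<close> can occur, and the right side is 0 by \<open>ln 0 = 0\<close>.\<close>

lemma ln_ln_ge_of_two_power_le:
  assumes "2 ^ k \<le> N + 1" "0 < k"
  shows "ln (real k) - 2 \<le> ln (ln (real N))"
proof (cases "N \<le> 1")
  case True
  have "(2::nat) ^ k < 2 ^ 2" using assms(1) True by simp
  then have "k < 2" by (rule power_less_imp_less_exp[rotated]) simp
  then have "k = 1" using assms(2) by simp
  moreover have "N = 0 \<or> N = 1" using True by auto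
  ultimately show ?thesis by auto
next
  case False
  have ln2: "1 / 2 \<le> ln (2::real)" using ln2_ge_two_thirds by simp
  have "real k / 4 \<le> ln (real N)"
  proof (cases "k = 1")
    case True
    have "ln 2 \<le> ln (real N)" using False by (subst ln_le_cancel_iff) auto
    then show ?thesis using True ln2 by simp
  next
    case k: False
    \<comment> \<open>From \<open>2 * 2^j <= N + 1\<close> one gets \<open>2^j <= N\<close>, hence
      \<open>ln N >= j / 2\<close>, and \<open>j / 2 >= (j + 1) / 4\<close> because
      \<open>j >= 1\<close>.\<close>
    then obtain j where j: "k = Suc j" "1 \<le> j" using assms(2) by (cases k) auto
    have "(1::nat) \<le> 2 ^ j" by simp
    then have "2 ^ j \<le> N" using assms(1) unfolding j(1) power_Suc by linarith
    then have "2 ^ j \<le> real N" by (metis of_nat_le_iff of_nat_numeral of_nat_power)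
    then have "ln (2 ^ j) \<le> ln (real N)" using False by (subst ln_le_cancel_iff) auto
    moreover have "ln (2 ^ j) = real j * ln (2::real)" by (simp add: ln_realpow)
    moreover have "real j * (1 / 2) \<le> real j * ln 2" using ln2 by (intro mult_left_mono) auto
    moreover have "real k = real j + 1" "1 \<le> real j" using j by auto
    ultimately show ?thesis by linarith
  qed
  then have "ln (real k / 4) \<le> ln (ln (real N))"
    using False assms(2) by (subst ln_le_cancel_iff) auto
  moreover have "ln (real k / 4) = ln (real k) - 2 * ln 2"
    using assms(2) ln_realpow[of 2 2] by (simp add: ln_div)
  ultimately show ?thesis using ln_2_less_1 by simp
qed

definition htop_at :: "('a::metric_space \<Rightarrow> 'a) \<Rightarrow> real \<Rightarrow> ereal" where
  "htop_at f e = limsup (\<lambda>n. ereal (ln (real (span_num f n e)) / real n))"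

definition EK_at :: "('a::metric_space \<Rightarrow> 'a) \<Rightarrow> 'a set set \<Rightarrow> real \<Rightarrow> ereal" where
  "EK_at f Z e = limsup (\<lambda>n. ereal (ln (ln (real (NK f Z n e))) / real n))"

text \<open>This monotonicity makes the limit as the scale tends to 0 exist as a supremum.\<close>

lemma htop_at_antimono:
  fixes f :: "'a::metric_space \<Rightarrow> 'a"
  assumes "compact (UNIV :: 'a set)" "continuous_on UNIV f" "0 < e" "e \<le> e'"
  shows "htop_at f e' \<le> htop_at f e"
proof -
  have "ln (real (span_num f n e')) / real n \<le> ln (real (span_num f n e)) / real n" for n
    using span_num_antimono[OF assms, of n] span_num_pos[OF assms(1,2), of e' n] assms(3,4)
    by (intro divide_right_mono) auto
  then show ?thesis
    unfolding htop_at_def by (intro Limsup_mono) simp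
qed

lemma EK_at_le_htop_at:
  fixes f :: "'a::metric_space \<Rightarrow> 'a"
  assumes "compact (UNIV :: 'a set)" "continuous_on UNIV f" "0 < e" "Z \<subseteq> hyperspace"
  shows "EK_at f Z e \<le> htop_at f e"
proof -
  have "ln (ln (real (NK f Z n e))) / real n \<le> ln (real (span_num f n e)) / real n" for n
    by (intro divide_right_mono ln_ln_le_of_le_two_power NK_le_power_span_num span_num_pos assms)
      simp
  then show ?thesis
    unfolding EK_at_def htop_at_def by (intro Limsup_mono) simp
qed

text \<open>The change of scale from \<open>r\<close> to \<open>e\<close> is harmless in the limit.
  After taking logarithms the linear factor only contributes \<open>u n\<close>, which tends to
  0.\<close>

lemma htop_at_le_EK_at:
  fixes f :: "'a::metric_space \<Rightarrow> 'a"
  assumes comp: "compact (UNIV :: 'a set)" and cont: "continuous_on UNIV f"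
    and spec: "has_specification f" and "0 < r" and e: "0 < e" "e < r / 16"
  shows "htop_at f r \<le> EK_at f (inv_hyperspace f) e"
proof -
  obtain s K where sK: "\<And>n. \<exists>k. span_num f n r \<le> (2 * ((n + s) * K) + 1) * k
      \<and> 2 ^ k \<le> NK f (inv_hyperspace f) n e + 1"
    using span_num_NK_lower_bound[OF comp cont spec \<open>0 < r\<close>] e by metis
  \<comment> \<open>Since \<open>n + s <= (s + 1) * (n + 1)\<close>, the linear factor is at most
    \<open>M * (n + 1)\<close> with \<open>M\<close> independent of \<open>n\<close>. The 2 in
    \<open>c\<close> below is the loss from \<open>ln_ln_ge_of_two_power_le\<close>.\<close>
  define M where "M = 2 * ((s + 1) * K) + 1"
  have "0 < M" by (simp add: M_def)
  define c where "c = ln (real M) + 2"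
  define u where "u n = (ln (real n + 1) + c) / real n" for n :: nat
  let ?N = "\<lambda>n. ln (ln (real (NK f (inv_hyperspace f) n e)))"
  have "ln (real (span_num f n r)) / real n \<le> u n + ?N n / real n" for n
  proof -
    obtain k where k: "span_num f n r \<le> (2 * ((n + s) * K) + 1) * k"
      "2 ^ k \<le> NK f (inv_hyperspace f) n e + 1"
      using sK by blast
    have pos: "0 < span_num f n r" by (rule span_num_pos[OF comp cont \<open>0 < r\<close>])
    then have "0 < k" using k(1) by (cases k) auto
    have "2 * ((n + s) * K) + 1 \<le> M * (n + 1)"
      by (simp add: algebra_simps M_def)
    then have "span_num f n r \<le> M * (n + 1) * k"
      using k(1) by (meson le_trans mult_le_mono1)
    then have "real (span_num f n r) \<le> real (M * (n + 1) * k)"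
      by (rule of_nat_mono)
    also have "\<dots> = real M * (real n + 1) * real k" by (simp add: algebra_simps)
    finally have "ln (real (span_num f n r)) \<le> ln (real M * (real n + 1) * real k)"
      using pos by simp
    also have "\<dots> = ln (real M) + ln (real n + 1) + ln (real k)"
      using \<open>0 < k\<close> \<open>0 < M\<close> by (simp add: ln_mult)
    also have "\<dots> \<le> ln (real n + 1) + c + ?N n"
      using ln_ln_ge_of_two_power_le[OF k(2) \<open>0 < k\<close>] by (simp add: c_def)
    finally have "ln (real (span_num f n r)) / real n \<le> (ln (real n + 1) + c + ?N n) / real n"
      by (rule divide_right_mono) simp
    then show ?thesis by (simp add: u_def add_divide_distrib)
  qed
  then have "htop_at f r \<le> limsup (\<lambda>n. ereal (u n) + ereal (?N n / real n))"
    unfolding htop_at_def by (intro Limsup_mono) simp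
  also have "\<dots> = 0 + EK_at f (inv_hyperspace f) e"
  proof -
    have "u \<longlonglongrightarrow> 0" unfolding u_def by real_asymp
    then have "(\<lambda>n. ereal (u n)) \<longlonglongrightarrow> 0" by (simp add: zero_ereal_def)
    then show ?thesis unfolding EK_at_def by (rule ereal_limsup_lim_add) simp
  qed
  finally show ?thesis by simp
qed

theorem theorem1p5:
  fixes f :: "'a::metric_space \<Rightarrow> 'a"
  assumes "compact (UNIV :: 'a set)"
    and "continuous_on UNIV f"
    and "pos_expansive f"
    and "has_specification f"
  shows "htop f = EK f (inv_hyperspace f)"
proof -
  \<comment> \<open>\<open>Lim\<close> is a definite description, so convergence must be proved
    before it can be evaluated; both rates are shown to tend to this supremum.\<close>
  define h where "h = (SUP e\<in>{0<..}. htop_at f e)"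
  have le_h: "htop_at f e \<le> h" if "0 < e" for e
    unfolding h_def using that by (auto intro: SUP_upper)
  have ev_pos: "eventually (\<lambda>e. 0 < e) (at_right (0::real))"
    by (rule eventually_at_right_less)
  have htop: "(htop_at f \<longlongrightarrow> h) (at_right 0)"
  proof (rule order_tendstoI)
    fix a assume "h < a"
    show "eventually (\<lambda>e. htop_at f e < a) (at_right 0)"
      using ev_pos by eventually_elim (meson le_h \<open>h < a\<close> le_less_trans)
  next
    fix a assume "a < h"
    then obtain r where r: "0 < r" "a < htop_at f r"
      unfolding h_def less_SUP_iff by auto
    have "eventually (\<lambda>e. e < r) (at_right 0)"
      using \<open>0 < r\<close> by (rule eventually_at_right_real[THEN eventually_mono]) auto
    with ev_pos show "eventually (\<lambda>e. a < htop_at f e) (at_right 0)"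
      by eventually_elim
        (meson htop_at_antimono[OF assms(1,2)] less_imp_le r(2) less_le_trans)
  qed
  \<comment> \<open>The upper bound compares both rates at the same scale. For the lower bound, some
    \<open>htop_at f r\<close> exceeds a given \<open>a < h\<close>, and then so does the hyperspace
    rate at every scale below \<open>r / 16\<close>.\<close>
  have EK: "(EK_at f (inv_hyperspace f) \<longlongrightarrow> h) (at_right 0)"
  proof (rule order_tendstoI)
    fix a assume "h < a"
    have "inv_hyperspace f \<subseteq> hyperspace" by (auto simp: inv_hyperspace_def)
    note le = EK_at_le_htop_at[OF assms(1,2) _ this]
    show "eventually (\<lambda>e. EK_at f (inv_hyperspace f) e < a) (at_right 0)"
      using ev_pos by eventually_elim (meson le le_h \<open>h < a\<close> le_less_trans)
  next
    fix a assume "a < h"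
    then obtain r where r: "0 < r" "a < htop_at f r"
      unfolding h_def less_SUP_iff by auto
    have "eventually (\<lambda>e. e \<in> {0<..<r / 16}) (at_right 0)"
      using \<open>0 < r\<close> by (intro eventually_at_right_real) simp
    then show "eventually (\<lambda>e. a < EK_at f (inv_hyperspace f) e) (at_right 0)"
      by eventually_elim
        (use htop_at_le_EK_at[OF assms(1,2,4) r(1)] r(2) in \<open>auto intro: less_le_trans\<close>)
  qed
  have "htop f = Lim (at_right 0) (htop_at f)"
    unfolding htop_def htop_at_def ..
  also have "\<dots> = h" by (rule tendsto_Lim[OF _ htop]) simp
  also have "\<dots> = Lim (at_right 0) (EK_at f (inv_hyperspace f))"
    by (rule tendsto_Lim[OF _ EK, symmetric]) simp
  also have "\<dots> = EK f (inv_hyperspace f)"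
    unfolding EK_def EK_at_def ..
  finally show ?thesis .
qed

end
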